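(* Let $p$ be a prime and let $n,m$ be positive integers. Let $G$ be a semi-extraspecial group with $|G:G'| = p^{2n}$ and $|G'| = p^m$ and exponent $p$. If $G$ contains elementary abelian subgroups $A$ and $B$ such that $G = AB$, then there exists a generalized nonsingular map $\alpha : V \times V \rightarrow W$, where $V$ and $W$ are elementary abelian $p$-groups of orders $p^n$ and $p^m$ respectively, such that $G \cong G(\alpha)$.
   Context: A finite $p$-group $G$ is semi-extraspecial if for every subgroup $N$ of index $p$ in $Z(G)$ the quotient $G/N$ is an extraspecial group. For elementary abelian $p$-groups $V,W$ written additively, a map $\alpha : V \times V \to W$ is a generalized nonsingular map if it is biadditive and $\alpha(v,V) = \alpha(V,v) = W$ for every $v \in V$ with $v \neq 0$, where $\alpha(v,V)=\{\alpha(v,u) : u\in V\}$ and $\alpha(V,v)=\{\alpha(u,v) : u \in V\}$. For such $\alpha$, the group $G(\alpha)$ is the set $V \times V \times W$ with multiplication $(a_1,b_1,c_1)(a_2,b_2,c_2) = (a_1+a_2,\, b_1+b_2,\, c_1+c_2+\alpha(a_1,b_2))$. *)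

theory Defs
  imports "HOL-Algebra.Generated_Groups" "HOL-Computational_Algebra.Primes"
begin

definition group_index :: "('a, 'b) monoid_scheme \<Rightarrow> 'a set \<Rightarrow> nat" where
  "group_index G H = card (rcosets\<^bsub>G\<^esub> H)"

definition center :: "('a, 'b) monoid_scheme \<Rightarrow> 'a set" where
  "center G = {z \<in> carrier G. \<forall>x \<in> carrier G. z \<otimes>\<^bsub>G\<^esub> x = x \<otimes>\<^bsub>G\<^esub> z}"

definition maximal_subgroup :: "'a set \<Rightarrow> ('a, 'b) monoid_scheme \<Rightarrow> bool" where
  "maximal_subgroup M G \<longleftrightarrow>
     subgroup M G \<and> M \<noteq> carrier G \<and>
     (\<forall>K. subgroup K G \<and> M \<subseteq> K \<longrightarrow> K = M \<or> K = carrier G)"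

(* The intersection with the carrier only matters if there are no maximal subgroups. *)
definition frattini :: "('a, 'b) monoid_scheme \<Rightarrow> 'a set" where
  "frattini G = carrier G \<inter> \<Inter>{M. maximal_subgroup M G}"

(* The least positive k with x^k = 1 for all x; only used for finite groups, where it exists. *)
definition group_exponent :: "('a, 'b) monoid_scheme \<Rightarrow> nat" where
  "group_exponent G = (LEAST k. 0 < k \<and> (\<forall>x \<in> carrier G. x [^]\<^bsub>G\<^esub> k = \<one>\<^bsub>G\<^esub>))"

definition finite_p_group :: "nat \<Rightarrow> ('a, 'b) monoid_scheme \<Rightarrow> bool" where
  "finite_p_group p G \<longleftrightarrow>
     Factorial_Ring.prime p \<and> group G \<and> finite (carrier G) \<and> (\<exists>k. Coset.order G = p ^ k)"

(* As usual, the trivial group counts as elementary abelian. *)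
definition elementary_abelian :: "nat \<Rightarrow> ('a, 'b) monoid_scheme \<Rightarrow> bool" where
  "elementary_abelian p G \<longleftrightarrow>
     Factorial_Ring.prime p \<and> comm_group G \<and> (\<forall>x \<in> carrier G. x [^]\<^bsub>G\<^esub> p = \<one>\<^bsub>G\<^esub>)"

definition extraspecial :: "nat \<Rightarrow> ('a, 'b) monoid_scheme \<Rightarrow> bool" where
  "extraspecial p G \<longleftrightarrow>
     finite_p_group p G \<and>
     center G = derived G (carrier G) \<and> center G = frattini G \<and> card (center G) = p"

definition semi_extraspecial :: "nat \<Rightarrow> ('a, 'b) monoid_scheme \<Rightarrow> bool" where
  "semi_extraspecial p G \<longleftrightarrow>
     finite_p_group p G \<and>
     (\<forall>N. subgroup N (G\<lparr>carrier := center G\<rparr>) \<and>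
          group_index (G\<lparr>carrier := center G\<rparr>) N = p \<longrightarrow> extraspecial p (G Mod N))"

(* HOL-Algebra groups are multiplicative, so the additively written groups V and W appear
   here with \<otimes> for + and \<one> for 0. The map is used only on carrier V x carrier V. *)
definition generalized_nonsingular ::
    "('v, 'c) monoid_scheme \<Rightarrow> ('w, 'd) monoid_scheme \<Rightarrow> ('v \<Rightarrow> 'v \<Rightarrow> 'w) \<Rightarrow> bool" where
  "generalized_nonsingular V W \<alpha> \<longleftrightarrow>
     (\<forall>v \<in> carrier V. (\<lambda>u. \<alpha> v u) \<in> hom V W) \<and>
     (\<forall>v \<in> carrier V. (\<lambda>u. \<alpha> u v) \<in> hom V W) \<and>
     (\<forall>v \<in> carrier V. v \<noteq> \<one>\<^bsub>V\<^esub> \<longrightarrow>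
        (\<lambda>u. \<alpha> v u) ` carrier V = carrier W \<and> (\<lambda>u. \<alpha> u v) ` carrier V = carrier W)"

definition group_of_map ::
    "('v, 'c) monoid_scheme \<Rightarrow> ('w, 'd) monoid_scheme \<Rightarrow> ('v \<Rightarrow> 'v \<Rightarrow> 'w) \<Rightarrow>
      ('v \<times> 'v \<times> 'w) monoid" where
  "group_of_map V W \<alpha> =
     \<lparr>carrier = carrier V \<times> carrier V \<times> carrier W,
      monoid.mult = (\<lambda>(a1, b1, c1) (a2, b2, c2).
        (a1 \<otimes>\<^bsub>V\<^esub> a2, b1 \<otimes>\<^bsub>V\<^esub> b2, c1 \<otimes>\<^bsub>W\<^esub> c2 \<otimes>\<^bsub>W\<^esub> \<alpha> a1 b2)),
      one = (\<one>\<^bsub>V\<^esub>, \<one>\<^bsub>V\<^esub>, \<one>\<^bsub>W\<^esub>)\<rparr>"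

end

theory Submission
  imports Defs "HOL-Algebra.Group_Action" "HOL-Algebra.Multiplicative_Group"
begin

text \<open>
  In a semi-extraspecial group \<open>G' = Z(G) = Z\<close>, and \<open>y \<mapsto> [x, y]\<close> is a homomorphism of \<open>G\<close> onto
  \<open>Z\<close> for every noncentral \<open>x\<close>: if its image were contained in a subgroup \<open>N\<close> of index \<open>p\<close> in \<open>Z\<close>,
  then \<open>x N\<close> would be central in \<open>G/N\<close>. Let \<open>A\<^sub>0\<close> and \<open>B\<^sub>0\<close> be complements of \<open>A \<inter> Z\<close> in \<open>A\<close> and of
  \<open>B \<inter> Z\<close> in \<open>B\<close>. Every element of \<open>G\<close> is uniquely a product \<open>b a z\<close> with \<open>b \<in> B\<^sub>0\<close>, \<open>a \<in> A\<^sub>0\<close>,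
  \<open>z \<in> Z\<close>, and \<open>[a, B\<^sub>0] = Z = [A\<^sub>0, b]\<close> for nontrivial \<open>a\<close> and \<open>b\<close>. Counting commuting pairs in
  \<open>A\<^sub>0 \<times> B\<^sub>0\<close> in two ways gives \<open>|A\<^sub>0| = |B\<^sub>0|\<close>, so there is an isomorphism \<open>\<phi>\<close> from \<open>A\<^sub>0\<close> to \<open>B\<^sub>0\<close>. Then
  \<open>\<alpha>(a, a') = [a, \<phi> a']\<close> is generalized nonsingular and \<open>(a, a', z) \<mapsto> \<phi>(a') a z\<close> is an isomorphism
  from \<open>G(\<alpha>)\<close> to \<open>G\<close>.
\<close>

subsection \<open>The center\<close>

lemma (in group) center_subgroup: "subgroup (center G) G"
proof (rule subgroupI)
  fix a b assume ab: "a \<in> center G" "b \<in> center G"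
  then have c: "a \<in> carrier G" "b \<in> carrier G"
    and com: "\<And>x. x \<in> carrier G \<Longrightarrow> a \<otimes> x = x \<otimes> a" "\<And>x. x \<in> carrier G \<Longrightarrow> b \<otimes> x = x \<otimes> b"
    by (auto simp: center_def)
  have "a \<otimes> b \<otimes> x = x \<otimes> (a \<otimes> b)" if x: "x \<in> carrier G" for x
  proof -
    have "a \<otimes> b \<otimes> x = a \<otimes> (x \<otimes> b)" using com(2)[OF x] c x by (simp add: m_assoc)
    also have "\<dots> = a \<otimes> x \<otimes> b" using c x by (simp add: m_assoc)
    also have "\<dots> = x \<otimes> (a \<otimes> b)" using com(1)[OF x] c x by (simp add: m_assoc)
    finally show ?thesis .
  qed
  then show "a \<otimes> b \<in> center G"
    using c by (simp add: center_def)
  have "inv a \<otimes> x = x \<otimes> inv a" if x: "x \<in> carrier G" for x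
    using com(1)[OF x] c x
    by (metis inv_closed inv_solve_left' inv_solve_right m_assoc m_closed)
  then show "inv a \<in> center G"
    using c by (simp add: center_def)
qed (auto simp: center_def)

lemma (in group) normal_of_subset_center:
  assumes "subgroup N G" and "N \<subseteq> center G"
  shows "N \<lhd> G"
proof -
  have "x \<otimes> h \<otimes> inv x \<in> N" if "x \<in> carrier G" "h \<in> N" for x h
  proof -
    have "h \<in> carrier G" "h \<otimes> x = x \<otimes> h"
      using that assms by (auto simp: center_def)
    then have "x \<otimes> h \<otimes> inv x = h"
      using that by (metis inv_solve_right' m_closed)
    then show ?thesis using that by simp
  qed
  then show ?thesis
    using assms(1) normal_inv_iff by blast
qed

text \<open>Under conjugation, a trivial center would leave exactly one orbit of size not divisible by \<open>p\<close>.\<close>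
lemma center_nontrivial:
  fixes G (structure)
  assumes "finite_p_group p G" and "carrier G \<noteq> {\<one>}"
  shows "center G \<noteq> {\<one>}"
proof
  assume triv: "center G = {\<one>}"
  interpret group G using assms by (simp add: finite_p_group_def)
  have p: "Factorial_Ring.prime p" and fin: "finite (carrier G)"
    using assms by (auto simp: finite_p_group_def)
  obtain k where k: "order G = p ^ k" using assms by (auto simp: finite_p_group_def)
  have k0: "k \<noteq> 0"
    using k assms(2) order_one_triv_iff by auto
  define \<phi> where "\<phi> = (\<lambda>g. (\<lambda>h \<in> carrier G. g \<otimes> h \<otimes> inv g))"
  interpret act: group_action G "carrier G" \<phi>
    unfolding \<phi>_def by (rule action_by_conjugation)
  let ?O = "orbits G (carrier G) \<phi>"
  have orb1: "orbit G \<phi> \<one> = {\<one>}"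
    unfolding orbit_def \<phi>_def by (auto intro!: exI[of _ \<one>])
  have memO: "{\<one>} \<in> ?O"
    unfolding orbits_def using orb1 by (metis (mono_tags, lifting) mem_Collect_eq one_closed)
  have dv: "p dvd card X" if X: "X \<in> ?O - {{\<one>}}" for X
  proof (rule ccontr)
    assume nd: "\<not> p dvd card X"
    obtain x where x: "x \<in> carrier G" "X = orbit G \<phi> x"
      using X by (auto simp: orbits_def)
    \<comment> \<open>Orbit sizes divide \<open>p ^ k\<close>, so one that is not a multiple of
      \<open>p\<close> is 1. A fixed point of conjugation is central, hence \<open>\<one>\<close> by
      \<open>triv\<close>, but the orbit of \<open>\<one>\<close> has been removed.\<close>
    have "card X dvd p ^ k"
      using act.orbit_stabilizer_theorem[OF x(1)] x(2) k by (metis dvd_triv_left)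
    then obtain i where "card X = p ^ i" using p divides_primepow_nat by blast
    with nd have "card X = 1" by (cases i) auto
    moreover have "x \<in> X" using act.orbit_refl x by auto
    ultimately have Xx: "X = {x}" by (metis card_1_singletonE singletonD)
    have "x \<in> center G"
    proof -
      have "x \<otimes> g = g \<otimes> x" if g: "g \<in> carrier G" for g
      proof -
        have "\<phi> g x \<in> X" using g x by (auto simp: orbit_def)
        then have "g \<otimes> x \<otimes> inv g = x" using Xx x by (simp add: \<phi>_def)
        then show ?thesis using g x by (metis inv_solve_right m_closed)
      qed
      then show ?thesis using x by (simp add: center_def)
    qed
    then show False using triv X Xx by auto
  qed
  have finO: "finite ?O"
    using fin act.orbits_coverture by (metis finite_UnionD)
  have "order G = (\<Sum>X\<in>?O. card X)"
    using act.disjoint_sum[OF fin, of "\<lambda>_. 1::nat"] by (simp add: order_def)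
  also have "\<dots> = card {\<one>} + (\<Sum>X\<in>?O - {{\<one>}}. card X)"
    by (rule sum.remove[OF finO memO])
  finally have "p ^ k = 1 + (\<Sum>X\<in>?O - {{\<one>}}. card X)" using k by simp
  moreover have "p dvd (\<Sum>X\<in>?O - {{\<one>}}. card X)" using dv by (rule dvd_sum)
  moreover have "p dvd p ^ k" using k0 by simp
  ultimately have "p dvd 1" by (metis dvd_add_left_iff)
  then show False using p by (simp add: prime_nat_iff)
qed

subsection \<open>Elementary abelian groups\<close>

text \<open>If \<open>p\<close> does not divide \<open>i\<close>, Bezout makes \<open>i\<close>
  invertible modulo \<open>p\<close>, so \<open>x\<close> is itself a power of
  \<open>x [^] i\<close>. Hence a cyclic group of order \<open>p\<close> either lies in
  \<open>S\<close> or meets it trivially.\<close>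

lemma (in group) subgroup_mem_of_prime_pow:
  fixes i :: int and p :: nat
  assumes p: "Factorial_Ring.prime p" and x: "x \<in> carrier G" "x [^] p = \<one>"
    and S: "subgroup S G" "x [^] i \<in> S"
  shows "x \<in> S \<or> x [^] i = \<one>"
proof (cases "int p dvd i")
  case True
  then obtain j where "i = int p * j" by auto
  then have "x [^] i = (x [^] int p) [^] j" using x by (simp add: int_pow_pow)
  also have "\<dots> = \<one>" using x by (simp add: int_pow_int)
  finally show ?thesis ..
next
  case False
  then have "coprime (int p) i" using p by (simp add: prime_imp_coprime)
  then obtain u v where uv: "u * int p + v * i = 1"
    using bezout_int[of "int p" i] by auto
  have "x = x [^] (int p * u + i * v)" using uv x by (simp add: mult.commute)
  also have "\<dots> = (x [^] int p) [^] u \<otimes> (x [^] i) [^] v"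
    using x by (simp add: int_pow_mult int_pow_pow)
  also have "\<dots> = (x [^] i) [^] v" using x by (simp add: int_pow_int)
  finally have "x = (x [^] i) [^] v" .
  then show ?thesis using subgroup_int_pow_closed[OF S] by metis
qed

lemma (in group) subset_set_mult:
  assumes "subgroup H G" "subgroup K G"
  shows "H \<subseteq> H <#> K" "K \<subseteq> H <#> K"
proof -
  have "h \<in> H <#> K" if "h \<in> H" for h
    using that assms subgroup.one_closed[of K G] subgroup.mem_carrier[of H G h]
    unfolding set_mult_def by (force intro: bexI[of _ h] bexI[of _ \<one>])
  moreover have "h \<in> H <#> K" if "h \<in> K" for h
    using that assms subgroup.one_closed[of H G] subgroup.mem_carrier[of K G h]
    unfolding set_mult_def by (force intro: bexI[of _ h] bexI[of _ \<one>])
  ultimately show "H \<subseteq> H <#> K" "K \<subseteq> H <#> K" by blast+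
qed

text \<open>\<open>N\<close> is a largest subgroup that contains \<open>I\<close> and meets
  \<open>K\<close> trivially. If \<open>x\<close> lay outside \<open>N K\<close>, adjoining
  \<open>x\<close> to \<open>N\<close> would preserve both properties. Prescribing \<open>I\<close>
  serves to enlarge a given subgroup to one of index \<open>p\<close>; a plain complement is the
  case of trivial \<open>I\<close>.\<close>

lemma elementary_abelian_complement:
  assumes "elementary_abelian p H" and fin: "finite (carrier H)"
    and I: "subgroup I H" and K: "subgroup K H" and IK: "I \<inter> K \<subseteq> {\<one>\<^bsub>H\<^esub>}"
  obtains N where "subgroup N H" "I \<subseteq> N" "N \<inter> K = {\<one>\<^bsub>H\<^esub>}" "N <#>\<^bsub>H\<^esub> K = carrier H"
proof -
  interpret comm_group H using assms by (simp add: elementary_abelian_def)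
  have p: "Factorial_Ring.prime p" and pw: "\<And>x. x \<in> carrier H \<Longrightarrow> x [^]\<^bsub>H\<^esub> p = \<one>\<^bsub>H\<^esub>"
    using assms by (auto simp: elementary_abelian_def)
  let ?P = "\<lambda>N. subgroup N H \<and> I \<subseteq> N \<and> N \<inter> K \<subseteq> {\<one>\<^bsub>H\<^esub>}"
  have "?P I" using I IK by blast
  \<comment> \<open>\<open>ex_has_greatest_nat\<close> asks for a strict bound on the cardinalities,
    hence the \<open>Suc\<close>.\<close>
  moreover have "\<forall>N. ?P N \<longrightarrow> card N < Suc (card (carrier H))"
    using fin by (simp add: subgroup.subset card_mono less_Suc_eq_le)
  ultimately have "\<exists>N. ?P N \<and> (\<forall>M. ?P M \<longrightarrow> card M \<le> card N)"
    by (rule Lattices_Big.ex_has_greatest_nat)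
  then obtain N where N: "?P N" and max: "\<And>M. ?P M \<Longrightarrow> card M \<le> card N"
    by (elim exE conjE) simp
  have NK: "subgroup (N <#>\<^bsub>H\<^esub> K) H" using N K mult_subgroups by blast
  have "carrier H \<subseteq> N <#>\<^bsub>H\<^esub> K"
  proof
    fix x assume x: "x \<in> carrier H"
    show "x \<in> N <#>\<^bsub>H\<^esub> K"
    proof (rule ccontr)
      assume nx: "x \<notin> N <#>\<^bsub>H\<^esub> K"
      let ?X = "generate H {x}"
      let ?M = "N <#>\<^bsub>H\<^esub> ?X"
      have X: "subgroup ?X H" using x generate_is_subgroup by simp
      have M: "subgroup ?M H" using N X mult_subgroups by blast
      have "?M \<inter> K \<subseteq> {\<one>\<^bsub>H\<^esub>}"
      proof
        fix y assume "y \<in> ?M \<inter> K"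
        then obtain n i where n: "n \<in> N" "y = n \<otimes>\<^bsub>H\<^esub> x [^]\<^bsub>H\<^esub> (i::int)" "y \<in> K"
          unfolding set_mult_def generate_pow[OF x] by auto
        have nc: "n \<in> carrier H" using n N subgroup.mem_carrier by metis
        \<comment> \<open>An element of \<open>?M\<close> in \<open>K\<close> puts a power of
          \<open>x\<close> into \<open>N K\<close>. Since \<open>x\<close> is not in
          \<open>N K\<close>, that power is trivial, so the element already lies in \<open>N\<close>
          and in \<open>K\<close>.\<close>
        have "x [^]\<^bsub>H\<^esub> i = inv\<^bsub>H\<^esub> n \<otimes>\<^bsub>H\<^esub> y"
          using n nc x by (simp add: m_assoc[symmetric])
        moreover have "inv\<^bsub>H\<^esub> n \<in> N" using n N subgroup.m_inv_closed by metis
        ultimately have "x [^]\<^bsub>H\<^esub> i \<in> N <#>\<^bsub>H\<^esub> K"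
          using n(3) unfolding set_mult_def by blast
        then have "x [^]\<^bsub>H\<^esub> i = \<one>\<^bsub>H\<^esub>"
          using subgroup_mem_of_prime_pow[OF p x pw[OF x] NK] nx by blast
        then have "y = n" using n nc by simp
        then show "y \<in> {\<one>\<^bsub>H\<^esub>}" using n N by blast
      qed
      moreover have "I \<subseteq> ?M" using subset_set_mult(1)[of N ?X] N X by blast
      ultimately have "card ?M \<le> card N" using M max by blast
      moreover have "N \<subseteq> ?M" using subset_set_mult(1)[of N ?X] N X by blast
      moreover have "finite ?M" using M fin by (meson finite_subset subgroup.subset)
      ultimately have "N = ?M" by (simp add: card_seteq)
      moreover have "x \<in> ?M" using subset_set_mult(2)[of N ?X] N X generate.incl[of x "{x}"] by blast
      ultimately have "x \<in> N" by simp
      then show False using subset_set_mult(1)[of N K] N K nx by blast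
    qed
  qed
  moreover have "N <#>\<^bsub>H\<^esub> K \<subseteq> carrier H" using NK subgroup.subset by blast
  moreover have "N \<inter> K = {\<one>\<^bsub>H\<^esub>}" using N K subgroup.one_closed by blast
  ultimately show thesis using that N by blast
qed

lemma (in group) card_complement:
  assumes "subgroup N G" "subgroup K G" "N \<inter> K = {\<one>}" "N <#> K = carrier G"
  shows "order G = card N * card K"
proof -
  interpret group_disjoint_sum G N K
    using assms by (simp add: group_disjoint_sum_def is_group)
  have "inj_on (\<lambda>(x, y). x \<otimes> y) (N \<times> K)"
    using cancel assms(3) by (auto simp: inj_on_def)
  moreover have "(\<lambda>(x, y). x \<otimes> y) ` (N \<times> K) = carrier G"
    unfolding assms(4)[symmetric] set_mult_def by force
  ultimately have "card (carrier G) = card (N \<times> K)"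
    by (metis card_image)
  then show ?thesis by (simp add: order_def card_cartesian_product)
qed

lemma (in group) card_generate_prime:
  assumes p: "Factorial_Ring.prime p" and x: "x \<in> carrier G" "x [^] p = \<one>" "x \<noteq> \<one>"
  shows "card (generate G {x}) = p"
proof -
  have "ord x dvd p" using x pow_eq_id by blast
  moreover have "ord x \<noteq> 1" using x ord_eq_1 by blast
  ultimately have "ord x = p" using p by (metis prime_nat_iff)
  then show ?thesis using generate_pow_card x by simp
qed

lemma (in group) generate_prime_Int:
  fixes p :: nat
  assumes p: "Factorial_Ring.prime p" and x: "x \<in> carrier G" "x [^] p = \<one>"
    and S: "subgroup S G" "x \<notin> S"
  shows "S \<inter> generate G {x} \<subseteq> {\<one>}"
  using subgroup_mem_of_prime_pow[OF p x S(1)] S(2) unfolding generate_pow[OF x(1)] by blast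

text \<open>For \<open>x\<close> outside \<open>I\<close>, a complement \<open>N\<close> of the
  group generated by \<open>x\<close> can be chosen to contain \<open>I\<close>. Its index is the
  order of \<open>x\<close>, which is \<open>p\<close>.\<close>

lemma elementary_abelian_proper_subgroup_le:
  assumes H: "elementary_abelian p H" and fin: "finite (carrier H)"
    and I: "subgroup I H" "I \<noteq> carrier H"
  obtains N where "subgroup N H" "I \<subseteq> N" "N \<noteq> carrier H" "group_index H N = p"
proof -
  interpret comm_group H using H by (simp add: elementary_abelian_def)
  have p: "Factorial_Ring.prime p" and pw: "\<And>x. x \<in> carrier H \<Longrightarrow> x [^]\<^bsub>H\<^esub> p = \<one>\<^bsub>H\<^esub>"
    using H by (auto simp: elementary_abelian_def)
  obtain x where x: "x \<in> carrier H" "x \<notin> I" using I subgroup.subset by blast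
  then have x1: "x \<noteq> \<one>\<^bsub>H\<^esub>" using I subgroup.one_closed by metis
  let ?X = "generate H {x}"
  have X: "subgroup ?X H" using x generate_is_subgroup by simp
  obtain N where N: "subgroup N H" "I \<subseteq> N" "N \<inter> ?X = {\<one>\<^bsub>H\<^esub>}" "N <#>\<^bsub>H\<^esub> ?X = carrier H"
    using elementary_abelian_complement[OF H fin I(1) X generate_prime_Int[OF p x(1) pw[OF x(1)] I(1) x(2)]]
    by blast
  have "order H = card N * p"
    using card_complement[OF N(1) X N(3,4)] card_generate_prime[OF p x(1) pw[OF x(1)] x1] by simp
  moreover have "card (rcosets\<^bsub>H\<^esub> N) * card N = order H" using lagrange N by blast
  moreover have "card N \<noteq> 0"
    using N(1) fin subgroup.finite_imp_card_positive by (metis less_irrefl)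
  ultimately have "group_index H N = p" by (simp add: group_index_def)
  moreover have "N \<noteq> carrier H"
    using N(3) x x1 generate.incl[of x "{x}" H] by blast
  ultimately show thesis using that N by blast
qed

section \<open>Elementary abelian groups are determined by their order\<close>

text \<open>The isomorphism sends \<open>i\<close> to \<open>x [^] i\<close>. Reducing exponents
  modulo \<open>p\<close> is harmless because \<open>x [^] p = \<one>\<close>, which gives
  additivity and surjectivity; injectivity follows since both sides have \<open>p\<close>
  elements.\<close>

lemma (in group) prime_cyclic_iso:
  fixes p :: nat
  assumes p: "Factorial_Ring.prime p" and x: "x \<in> carrier G" "x [^] p = \<one>" "x \<noteq> \<one>"
  shows "integer_mod_group p \<cong> subgroup_generated G {x}"
proof -
  have p0: "p > 0" using p prime_gt_0_nat by blast
  let ?f = "\<lambda>i::int. x [^] i"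
  have md: "x [^] (i mod int p) = x [^] i" for i :: int
  proof -
    have "x [^] i = x [^] (int p * (i div int p) + i mod int p)" by simp
    also have "\<dots> = (x [^] int p) [^] (i div int p) \<otimes> x [^] (i mod int p)"
      using x by (simp only: int_pow_mult int_pow_pow)
    finally show ?thesis using x by (simp add: int_pow_int)
  qed
  have carr: "carrier (subgroup_generated G {x}) = generate G {x}"
    using x by (simp add: carrier_subgroup_generated)
  have img: "?f ` carrier (integer_mod_group p) = generate G {x}"
  proof
    show "?f ` carrier (integer_mod_group p) \<subseteq> generate G {x}"
      unfolding generate_pow[OF x(1)] by blast
    show "generate G {x} \<subseteq> ?f ` carrier (integer_mod_group p)"
    proof
      fix y assume "y \<in> generate G {x}"
      then obtain i :: int where "y = x [^] i" unfolding generate_pow[OF x(1)] by blast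
      then have "y = ?f (i mod int p)" by (simp add: md)
      moreover have "i mod int p \<in> carrier (integer_mod_group p)"
        using p0 by (simp add: carrier_integer_mod_group)
      ultimately show "y \<in> ?f ` carrier (integer_mod_group p)" by blast
    qed
  qed
  have "card (generate G {x}) = card (carrier (integer_mod_group p))"
    using card_generate_prime[OF p x] p0 by (simp add: carrier_integer_mod_group)
  moreover have "finite (carrier (integer_mod_group p))"
    using p0 by (simp add: carrier_integer_mod_group)
  ultimately have "inj_on ?f (carrier (integer_mod_group p))"
    by (intro eq_card_imp_inj_on) (simp_all add: img)
  moreover have "?f \<in> hom (integer_mod_group p) (subgroup_generated G {x})"
  proof (rule homI)
    show "x [^] i \<in> carrier (subgroup_generated G {x})" for i :: int
      unfolding carr generate_pow[OF x(1)] by blast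
  qed (use x in \<open>simp add: md int_pow_mult\<close>)
  ultimately have "?f \<in> iso (integer_mod_group p) (subgroup_generated G {x})"
    unfolding iso_def bij_betw_def using img carr by simp
  then show ?thesis by (rule is_isoI)
qed

lemma elementary_abelian_subgroup:
  assumes "elementary_abelian p G" and "subgroup H G"
  shows "elementary_abelian p (G\<lparr>carrier := H\<rparr>)"
proof -
  interpret comm_group G using assms(1) by (simp add: elementary_abelian_def)
  have "comm_group (G\<lparr>carrier := H\<rparr>)"
    using subgroup_imp_group[OF assms(2)] subgroup.mem_carrier[OF assms(2)] m_comm
    by (intro group.group_comm_groupI) auto
  moreover have "x [^]\<^bsub>G\<lparr>carrier := H\<rparr>\<^esub> p = \<one>\<^bsub>G\<^esub>" if "x \<in> H" for x
    using assms that nat_pow_consistent[of x p H] subgroup.mem_carrier[OF assms(2) that]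
    by (simp add: elementary_abelian_def)
  ultimately show ?thesis
    using assms(1) by (simp add: elementary_abelian_def)
qed

text \<open>Any nontrivial element generates a factor of order \<open>p\<close>, and a complement of
  it serves as \<open>N\<close>. The factor is replaced by \<open>integer_mod_group p\<close> so
  that two different groups split off the same one.\<close>

lemma elementary_abelian_split:
  assumes H: "elementary_abelian p H" and fin: "finite (carrier H)" and nt: "carrier H \<noteq> {\<one>\<^bsub>H\<^esub>}"
  obtains N where "subgroup N H" "order H = card N * p"
    "H\<lparr>carrier := N\<rparr> \<times>\<times> integer_mod_group p \<cong> H"
proof -
  interpret comm_group H using H by (simp add: elementary_abelian_def)
  have p: "Factorial_Ring.prime p" and pw: "\<And>x. x \<in> carrier H \<Longrightarrow> x [^]\<^bsub>H\<^esub> p = \<one>\<^bsub>H\<^esub>"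
    using H by (auto simp: elementary_abelian_def)
  obtain x where x: "x \<in> carrier H" "x \<noteq> \<one>\<^bsub>H\<^esub>" using nt by auto
  let ?X = "generate H {x}"
  have X: "subgroup ?X H" using x generate_is_subgroup by simp
  obtain N where N: "subgroup N H" "N \<inter> ?X = {\<one>\<^bsub>H\<^esub>}" "N <#>\<^bsub>H\<^esub> ?X = carrier H"
    using elementary_abelian_complement[OF H fin triv_subgroup X Int_lower1] .
  interpret group_disjoint_sum H N ?X
    using N X by (simp add: group_disjoint_sum_def group_axioms)
  have "(\<lambda>(x, y). x \<otimes>\<^bsub>H\<^esub> y) \<in> iso (subgroup_generated H N \<times>\<times> subgroup_generated H ?X) H"
    using iso_group_mul[OF comm_group_axioms] N by blast
  \<comment> \<open>\<open>iso_group_mul\<close> is phrased with \<open>subgroup_generated\<close>,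
    which for a subgroup is the restriction of the carrier.\<close>
  moreover have "subgroup_generated H N = H\<lparr>carrier := N\<rparr>"
    using AG.carrier_subgroup_generated_subgroup
    by (simp add: subgroup_generated_def carrier_subgroup_generated)
  moreover have "subgroup_generated H ?X = subgroup_generated H {x}"
    using BG.carrier_subgroup_generated_subgroup x
    by (simp add: subgroup_generated_def carrier_subgroup_generated)
  ultimately have 1: "H\<lparr>carrier := N\<rparr> \<times>\<times> subgroup_generated H {x} \<cong> H"
    using is_isoI by metis
  have "H\<lparr>carrier := N\<rparr> \<times>\<times> integer_mod_group p \<cong> H\<lparr>carrier := N\<rparr> \<times>\<times> subgroup_generated H {x}"
    using group.DirProd_iso_trans[OF subgroup_imp_group[OF N(1)] iso_refl
        prime_cyclic_iso[OF p x(1) pw[OF x(1)] x(2)]] by simp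
  then have "H\<lparr>carrier := N\<rparr> \<times>\<times> integer_mod_group p \<cong> H"
    using 1 iso_trans by blast
  then show thesis
    using that[OF N(1)] card_complement[OF N(1) X N(2,3)]
      card_generate_prime[OF p x(1) pw[OF x(1)] x(2)] by simp
qed

text \<open>Induction on the order: splitting off one factor of order \<open>p\<close> from each
  group leaves smaller groups of equal order. The complements are restrictions of \<open>H\<close>
  and \<open>K\<close> to smaller carriers, so they keep their types and the induction hypothesis
  applies.\<close>

lemma elementary_abelian_iso:
  fixes H :: "('a, 'b) monoid_scheme" and K :: "('c, 'd) monoid_scheme"
  assumes "elementary_abelian p H" "elementary_abelian p K"
    and "finite (carrier H)" "order H = order K"
  shows "H \<cong> K"
  using assms
proof (induction "order H" arbitrary: H K rule: less_induct)
  case less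
  interpret H: comm_group H using less.prems by (simp add: elementary_abelian_def)
  interpret K: comm_group K using less.prems by (simp add: elementary_abelian_def)
  have p: "Factorial_Ring.prime p" using less.prems by (simp add: elementary_abelian_def)
  have finK: "finite (carrier K)"
    using less.prems H.order_gt_0_iff_finite K.order_gt_0_iff_finite by simp
  show ?case
  proof (cases "order H = 1")
    case True
    then have "carrier H = {\<one>\<^bsub>H\<^esub>}" "carrier K = {\<one>\<^bsub>K\<^esub>}"
      using less.prems H.order_one_triv_iff K.order_one_triv_iff by simp_all
    then have "(\<lambda>_. \<one>\<^bsub>K\<^esub>) \<in> iso H K"
      by (auto simp: iso_def hom_def bij_betw_def)
    then show ?thesis by (rule is_isoI)
  next
    case False
    then have nt: "carrier H \<noteq> {\<one>\<^bsub>H\<^esub>}" "carrier K \<noteq> {\<one>\<^bsub>K\<^esub>}"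
      using less.prems H.order_one_triv_iff K.order_one_triv_iff by simp_all
    obtain N where N: "subgroup N H" "order H = card N * p"
        "H\<lparr>carrier := N\<rparr> \<times>\<times> integer_mod_group p \<cong> H"
      using elementary_abelian_split[OF less.prems(1,3) nt(1)] .
    obtain M where M: "subgroup M K" "order K = card M * p"
        "K\<lparr>carrier := M\<rparr> \<times>\<times> integer_mod_group p \<cong> K"
      using elementary_abelian_split[OF less.prems(2) finK nt(2)] .
    have finN: "finite N" using N(1) less.prems(3) by (meson finite_subset subgroup.subset)
    have "card N > 0" using subgroup.finite_imp_card_positive[OF N(1) less.prems(3)] .
    then have "order (H\<lparr>carrier := N\<rparr>) < order H"
      using N(2) prime_gt_1_nat[OF p] by (simp add: order_def)
    moreover have "order (H\<lparr>carrier := N\<rparr>) = order (K\<lparr>carrier := M\<rparr>)"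
      using N(2) M(2) less.prems(4) prime_gt_0_nat[OF p] by (simp add: order_def)
    ultimately have "H\<lparr>carrier := N\<rparr> \<cong> K\<lparr>carrier := M\<rparr>"
      using less.hyps[of "H\<lparr>carrier := N\<rparr>" "K\<lparr>carrier := M\<rparr>"]
        elementary_abelian_subgroup[OF less.prems(1) N(1)]
        elementary_abelian_subgroup[OF less.prems(2) M(1)] finN by simp
    then have "H\<lparr>carrier := N\<rparr> \<times>\<times> integer_mod_group p \<cong> K\<lparr>carrier := M\<rparr> \<times>\<times> integer_mod_group p"
      using group.DirProd_iso_trans[OF H.subgroup_imp_group[OF N(1)] _ iso_refl] by blast
    then have "H\<lparr>carrier := N\<rparr> \<times>\<times> integer_mod_group p \<cong> K"
      using M(3) by (rule iso_trans)
    moreover have "H \<cong> H\<lparr>carrier := N\<rparr> \<times>\<times> integer_mod_group p"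
      using group.iso_sym[OF DirProd_group[OF H.subgroup_imp_group[OF N(1)] group_integer_mod_group] N(3)] .
    ultimately show ?thesis using iso_trans by blast
  qed
qed

text \<open>First isomorphism theorem combined with Lagrange's theorem.\<close>

lemma (in group_hom) card_kernel:
  assumes "h ` carrier G = carrier H"
  shows "card (kernel G H h) * order H = order G"
proof -
  have "card (carrier (G Mod kernel G H h)) = card (carrier H)"
    using FactGroup_iso[OF assms] iso_same_card by blast
  then have "card (rcosets kernel G H h) = order H"
    by (simp add: FactGroup_def order_def)
  then show ?thesis using G.lagrange[OF subgroup_kernel] by (simp add: mult.commute)
qed

text \<open>Subgroups of \<open>G\<close> inherit the extra record fields of \<open>G\<close>;
  truncation drops them, which yields groups of type \<open>'a monoid\<close> as the theorem demands
  of \<open>V\<close> and \<open>W\<close>.\<close>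

lemma elementary_abelian_truncate:
  assumes "elementary_abelian p G"
  shows "elementary_abelian p (monoid.truncate G)"
proof -
  interpret comm_group G using assms by (simp add: elementary_abelian_def)
  have "comm_group (monoid.truncate G)"
    by (rule comm_groupI) (auto simp: monoid.truncate_def m_assoc intro: m_comm l_inv_ex)
  moreover have "x [^]\<^bsub>monoid.truncate G\<^esub> k = x [^]\<^bsub>G\<^esub> k" for x and k :: nat
    by (simp add: nat_pow_def monoid.truncate_def)
  ultimately show ?thesis
    using assms by (simp add: elementary_abelian_def monoid.truncate_def)
qed

subsection \<open>Commutators\<close>

text \<open>This order of factors matches the generators of \<open>derived\<close> and gives
  \<open>x y = [x, y] y x\<close>.\<close>

definition commutator :: "('a, 'b) monoid_scheme \<Rightarrow> 'a \<Rightarrow> 'a \<Rightarrow> 'a" where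
  "commutator G x y = x \<otimes>\<^bsub>G\<^esub> y \<otimes>\<^bsub>G\<^esub> inv\<^bsub>G\<^esub> x \<otimes>\<^bsub>G\<^esub> inv\<^bsub>G\<^esub> y"

context group
begin

lemma commutator_closed [simp]:
  "x \<in> carrier G \<Longrightarrow> y \<in> carrier G \<Longrightarrow> commutator G x y \<in> carrier G"
  by (simp add: commutator_def)

lemma commutator_swap:
  assumes "x \<in> carrier G" "y \<in> carrier G"
  shows "x \<otimes> y = commutator G x y \<otimes> (y \<otimes> x)"
proof -
  have "inv y \<otimes> (y \<otimes> x) = x" using assms by (simp add: m_assoc[symmetric])
  then show ?thesis
    unfolding commutator_def using assms by (simp add: m_assoc)
qed

text \<open>Cancel \<open>y \<otimes> x\<close> on the right. Commutator identities can thus be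
  checked without expanding inverses.\<close>

lemma commutator_unique:
  assumes "x \<in> carrier G" "y \<in> carrier G" "c \<in> carrier G" and "x \<otimes> y = c \<otimes> (y \<otimes> x)"
  shows "commutator G x y = c"
  using assms commutator_swap[OF assms(1,2)]
  by (metis commutator_closed m_closed right_cancel)

lemma commutator_eq_one_iff:
  assumes "x \<in> carrier G" "y \<in> carrier G"
  shows "commutator G x y = \<one> \<longleftrightarrow> x \<otimes> y = y \<otimes> x"
  using assms commutator_unique[of x y \<one>] commutator_swap[of x y] by auto

lemma center_commute:
  assumes "z \<in> center G" "x \<in> carrier G"
  shows "z \<otimes> x = x \<otimes> z"
  using assms by (simp add: center_def)

text \<open>In general \<open>[x y, z]\<close> is the conjugate of \<open>[y, z]\<close> by
  \<open>x\<close>, times \<open>[x, z]\<close>. Centrality removes the conjugation.\<close>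

lemma commutator_mult_left:
  assumes c: "x \<in> carrier G" "y \<in> carrier G" "z \<in> carrier G"
    and Z: "commutator G x z \<in> center G" "commutator G y z \<in> center G"
  shows "commutator G (x \<otimes> y) z = commutator G x z \<otimes> commutator G y z"
proof (rule commutator_unique)
  let ?c = "commutator G x z" and ?d = "commutator G y z"
  have "x \<otimes> y \<otimes> z = x \<otimes> (?d \<otimes> (z \<otimes> y))"
    using c commutator_swap[of y z] by (simp add: m_assoc)
  also have "\<dots> = ?d \<otimes> (x \<otimes> z) \<otimes> y"
    using c center_commute[OF Z(2), of x] by (simp add: m_assoc[symmetric])
  also have "\<dots> = ?d \<otimes> (?c \<otimes> (z \<otimes> x)) \<otimes> y"
    using c commutator_swap[of x z] by simp
  also have "\<dots> = ?c \<otimes> ?d \<otimes> (z \<otimes> (x \<otimes> y))"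
    using c center_commute[OF Z(1), of ?d] by (simp add: m_assoc[symmetric])
  finally show "x \<otimes> y \<otimes> z = ?c \<otimes> ?d \<otimes> (z \<otimes> (x \<otimes> y))" .
qed (use c in auto)

lemma commutator_mult_right:
  assumes c: "x \<in> carrier G" "y \<in> carrier G" "z \<in> carrier G"
    and Z: "commutator G x y \<in> center G" "commutator G x z \<in> center G"
  shows "commutator G x (y \<otimes> z) = commutator G x y \<otimes> commutator G x z"
proof (rule commutator_unique)
  let ?c = "commutator G x y" and ?d = "commutator G x z"
  have "x \<otimes> (y \<otimes> z) = ?c \<otimes> (y \<otimes> x) \<otimes> z"
    using c commutator_swap[of x y] by (simp add: m_assoc[symmetric])
  also have "\<dots> = ?c \<otimes> (y \<otimes> (?d \<otimes> (z \<otimes> x)))"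
    using c commutator_swap[of x z] by (simp add: m_assoc)
  also have "\<dots> = ?c \<otimes> ((y \<otimes> ?d) \<otimes> (z \<otimes> x))"
    using c by (simp add: m_assoc)
  also have "\<dots> = ?c \<otimes> ?d \<otimes> (y \<otimes> z \<otimes> x)"
    using c center_commute[OF Z(2), of y, symmetric] by (simp add: m_assoc)
  finally show "x \<otimes> (y \<otimes> z) = ?c \<otimes> ?d \<otimes> (y \<otimes> z \<otimes> x)" .
qed (use c in auto)

lemma commutator_in_derived:
  assumes "x \<in> carrier G" "y \<in> carrier G"
  shows "commutator G x y \<in> derived G (carrier G)"
  unfolding derived_def commutator_def using assms by (intro generate.incl) blast

end

subsection \<open>Semi-extraspecial groups\<close>

text \<open>The trivial group is semi-extraspecial vacuously; \<open>nonabelian\<close> excludes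
  it.\<close>

locale semi_extraspecial_group = group G for G (structure) and p :: nat +
  assumes ses: "semi_extraspecial p G"
    and pow_p: "\<And>x. x \<in> carrier G \<Longrightarrow> x [^] p = \<one>"
    and nonabelian: "derived G (carrier G) \<noteq> {\<one>}"
begin

lemma p_group: "finite_p_group p G"
  and prime_p: "Factorial_Ring.prime p"
  and finite_carrier: "finite (carrier G)"
  using ses by (auto simp: semi_extraspecial_def finite_p_group_def)

lemma center_in_carrier: "z \<in> center G \<Longrightarrow> z \<in> carrier G"
  by (simp add: center_def)

lemma finite_center: "finite (center G)"
  using finite_carrier by (simp add: center_def)

lemma elementary_abelian_center: "elementary_abelian p (G\<lparr>carrier := center G\<rparr>)"
proof -
  have "comm_group (G\<lparr>carrier := center G\<rparr>)"
    using subgroup_imp_group[OF center_subgroup] center_commute center_in_carrier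
    by (intro group.group_comm_groupI) auto
  moreover have "x [^]\<^bsub>G\<lparr>carrier := center G\<rparr>\<^esub> p = \<one>" if "x \<in> center G" for x
    using pow_p[OF center_in_carrier[OF that]] nat_pow_consistent[of x p "center G"] by simp
  ultimately show ?thesis using prime_p by (simp add: elementary_abelian_def)
qed

section \<open>Quotients by a central subgroup of index \<open>p\<close>\<close>

context
  fixes N
  assumes N: "subgroup N G" "N \<subseteq> center G" and index: "group_index (G\<lparr>carrier := center G\<rparr>) N = p"
begin

lemma extraspecial_quotient: "extraspecial p (G Mod N)"
  using ses N index subgroup_incl[OF N(1) center_subgroup N(2)]
  by (simp add: semi_extraspecial_def)

lemma normal_N: "N \<lhd> G"
  using normal_of_subset_center N by blast

text \<open>The image of the center is always central in the quotient, and here both sets have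
  exactly \<open>p\<close> elements.\<close>

lemma center_quotient: "center (G Mod N) = (\<lambda>z. N #> z) ` center G"
proof -
  interpret N: normal N G by (rule normal_N)
  have card: "card (center (G Mod N)) = p"
    using extraspecial_quotient unfolding extraspecial_def by blast
  then have fin: "finite (center (G Mod N))"
    using prime_gt_0_nat[OF prime_p] card_gt_0_iff by metis
  have sub: "(\<lambda>z. N #> z) ` center G \<subseteq> center (G Mod N)"
    by (auto simp: center_def carrier_FactGroup N.rcos_sum)
  have "(\<lambda>z. N #> z) ` center G = rcosets\<^bsub>G\<lparr>carrier := center G\<rparr>\<^esub> N"
    by (auto simp: RCOSETS_def)
  then have "card ((\<lambda>z. N #> z) ` center G) = p"
    using index by (simp add: group_index_def)
  then show ?thesis using card_subset_eq[OF fin sub] card by simp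
qed

lemma central_of_coset_central:
  assumes x: "x \<in> carrier G" and c: "N #> x \<in> center (G Mod N)"
  shows "x \<in> center G"
proof -
  interpret N: normal N G by (rule normal_N)
  obtain z where z: "z \<in> center G" "N #> x = N #> z" using c center_quotient by auto
  have "x \<in> N #> z" using z rcos_self[OF x N(1)] by simp
  then obtain h where "h \<in> N" "x = h \<otimes> z" by (auto simp: r_coset_def)
  then show ?thesis using z N(2) subgroup.m_closed[OF center_subgroup] by auto
qed

text \<open>Modulo \<open>N\<close> the element \<open>x\<close> commutes with everything, and
  centrality lifts from the quotient. Contrapositively, the commutators of a noncentral
  \<open>x\<close> escape every such \<open>N\<close>.\<close>

lemma central_of_commutators_in:
  assumes x: "x \<in> carrier G" and c: "\<And>y. y \<in> carrier G \<Longrightarrow> commutator G x y \<in> N"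
  shows "x \<in> center G"
proof (rule central_of_coset_central[OF x])
  interpret N: normal N G by (rule normal_N)
  have "(N #> x) <#> (N #> y) = (N #> y) <#> (N #> x)" if y: "y \<in> carrier G" for y
  proof -
    have "N #> (x \<otimes> y) = N #> (commutator G x y \<otimes> (y \<otimes> x))"
      using commutator_swap[OF x y] by simp
    also have "\<dots> = (N #> commutator G x y) #> (y \<otimes> x)"
      using x y N.subset by (simp add: coset_mult_assoc)
    also have "\<dots> = N #> (y \<otimes> x)"
      using c[OF y] x y N(1) by (simp add: coset_join2)
    finally show ?thesis using x y by (simp add: N.rcos_sum)
  qed
  then show "N #> x \<in> center (G Mod N)"
    using x by (auto simp: center_def carrier_FactGroup)
qed

text \<open>The projection maps the derived subgroup onto that of the quotient, which is the center
  there because the quotient is extraspecial; centrality then lifts back.\<close>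

lemma derived_subset_center_of_index: "derived G (carrier G) \<subseteq> center G"
proof
  interpret N: normal N G by (rule normal_N)
  interpret q: group_hom G "G Mod N" "\<lambda>x. N #> x"
    using N.factorgroup_is_group N.r_coset_hom_Mod
    by (simp add: group_hom_def group_hom_axioms_def group_axioms)
  fix d assume d: "d \<in> derived G (carrier G)"
  have "derived (G Mod N) (carrier (G Mod N)) = (\<lambda>x. N #> x) ` derived G (carrier G)"
    using q.derived_img[OF subset_refl] by (simp add: carrier_FactGroup)
  then have "N #> d \<in> center (G Mod N)"
    using d extraspecial_quotient unfolding extraspecial_def by blast
  then show "d \<in> center G"
    using central_of_coset_central d derived_in_carrier[OF subset_refl] by blast
qed

end

section \<open>The derived subgroup, the center and the commutator maps\<close>

lemma maximal_central_subgroup: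
  assumes "subgroup I G" "I \<subset> center G"
  obtains N where "subgroup N G" "I \<subseteq> N" "N \<subset> center G"
    "group_index (G\<lparr>carrier := center G\<rparr>) N = p"
proof -
  have I: "subgroup I (G\<lparr>carrier := center G\<rparr>)"
    using assms subgroup_incl[OF _ center_subgroup] by blast
  obtain N where N: "subgroup N (G\<lparr>carrier := center G\<rparr>)" "I \<subseteq> N"
      "N \<noteq> carrier (G\<lparr>carrier := center G\<rparr>)" "group_index (G\<lparr>carrier := center G\<rparr>) N = p"
    using elementary_abelian_proper_subgroup_le[OF elementary_abelian_center _ I] finite_center assms(2)
    by auto
  have "subgroup N G" using incl_subgroup[OF center_subgroup N(1)] .
  moreover have "N \<subset> center G" using N(3) subgroup.subset[OF N(1)] by auto
  ultimately show thesis using that N by blast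
qed

text \<open>It remains to see that some central subgroup of index \<open>p\<close> exists. The
  center of a nontrivial \<open>p\<close>-group is nontrivial, so \<open>{\<one>}\<close> is proper
  in it and can be enlarged.\<close>

lemma derived_subset_center: "derived G (carrier G) \<subseteq> center G"
proof -
  have "carrier G \<noteq> {\<one>}"
    using nonabelian derived_in_carrier[OF subset_refl]
      subgroup.one_closed[OF derived_is_subgroup[OF subset_refl]] by blast
  then have "center G \<noteq> {\<one>}" using center_nontrivial p_group by blast
  then have "{\<one>} \<subset> center G" using subgroup.one_closed[OF center_subgroup] by blast
  then obtain N where "subgroup N G" "N \<subset> center G" "group_index (G\<lparr>carrier := center G\<rparr>) N = p"
    using maximal_central_subgroup[OF triv_subgroup] by blast
  then show ?thesis using derived_subset_center_of_index by blast
qed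

lemma commutator_central [simp]:
  "x \<in> carrier G \<Longrightarrow> y \<in> carrier G \<Longrightarrow> commutator G x y \<in> center G"
  using subsetD[OF derived_subset_center commutator_in_derived] .

lemma commutator_biadditive:
  assumes "x \<in> carrier G" "y \<in> carrier G" "z \<in> carrier G"
  shows "commutator G (x \<otimes> y) z = commutator G x z \<otimes> commutator G y z"
    and "commutator G x (y \<otimes> z) = commutator G x y \<otimes> commutator G x z"
  using assms by (simp_all only: commutator_mult_left commutator_mult_right commutator_central)

lemma commutator_hom_right:
  assumes "x \<in> carrier G"
  shows "group_hom G (G\<lparr>carrier := center G\<rparr>) (commutator G x)"
proof -
  have "commutator G x \<in> hom G (G\<lparr>carrier := center G\<rparr>)"
    using assms by (intro homI) (simp_all add: commutator_biadditive)
  then show ?thesis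
    using subgroup_imp_group[OF center_subgroup] group_axioms
    by (simp add: group_hom_def group_hom_axioms_def)
qed

lemma commutator_image:
  assumes x: "x \<in> carrier G" "x \<notin> center G"
  shows "commutator G x ` carrier G = center G"
proof (rule ccontr)
  interpret c: group_hom G "G\<lparr>carrier := center G\<rparr>" "commutator G x"
    using commutator_hom_right x by blast
  assume "commutator G x ` carrier G \<noteq> center G"
  then have "commutator G x ` carrier G \<subset> center G" using x by auto
  moreover have "subgroup (commutator G x ` carrier G) G"
    using incl_subgroup[OF center_subgroup c.img_is_subgroup] .
  ultimately obtain N where N: "subgroup N G" "commutator G x ` carrier G \<subseteq> N" "N \<subset> center G"
      "group_index (G\<lparr>carrier := center G\<rparr>) N = p"
    using maximal_central_subgroup by blast
  then have "x \<in> center G"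
    using central_of_commutators_in[OF N(1) _ N(4) x(1)] by blast
  then show False using x by blast
qed

text \<open>A single noncentral \<open>x\<close> suffices for the remaining inclusion, since its
  commutators already fill the center.\<close>

lemma derived_eq_center: "derived G (carrier G) = center G"
proof
  have "\<not> carrier G \<subseteq> center G"
  proof
    assume "carrier G \<subseteq> center G"
    then have "comm_group G" using center_commute by (intro group_comm_groupI) auto
    then show False using comm_group.derived_eq_singleton[of G "carrier G"] nonabelian by blast
  qed
  then obtain x where x: "x \<in> carrier G" "x \<notin> center G" by blast
  show "center G \<subseteq> derived G (carrier G)"
    unfolding commutator_image[OF x, symmetric] using commutator_in_derived[OF x(1)] by blast
qed (rule derived_subset_center)

end

subsection \<open>Factorizations into abelian subgroups\<close>

text \<open>\<open>A\<close> and \<open>B\<close> are complements of the central parts of the two given abelian factors.\<close>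
locale central_factorization = semi_extraspecial_group +
  fixes A B
  assumes A: "subgroup A G" and B: "subgroup B G"
    and comm_A: "\<And>x y. \<lbrakk>x \<in> A; y \<in> A\<rbrakk> \<Longrightarrow> x \<otimes> y = y \<otimes> x"
    and comm_B: "\<And>x y. \<lbrakk>x \<in> B; y \<in> B\<rbrakk> \<Longrightarrow> x \<otimes> y = y \<otimes> x"
    and A_center: "A \<inter> center G = {\<one>}" and B_center: "B \<inter> center G = {\<one>}"
    and factor: "\<And>g. g \<in> carrier G \<Longrightarrow> \<exists>b\<in>B. \<exists>a\<in>A. \<exists>z\<in>center G. g = b \<otimes> a \<otimes> z"
begin

lemma mem_carrier [simp]:
  "x \<in> A \<Longrightarrow> x \<in> carrier G" "x \<in> B \<Longrightarrow> x \<in> carrier G" "x \<in> center G \<Longrightarrow> x \<in> carrier G"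
  using A B subgroup.mem_carrier center_in_carrier by metis+

text \<open>Inverting a factorization of \<open>inv g\<close> reverses the two factors, so every
  result about \<open>A\<close> also holds for \<open>B\<close>.\<close>

lemma central_factorization_swap: "central_factorization G p B A"
proof (intro central_factorization.intro central_factorization_axioms.intro semi_extraspecial_group_axioms)
  fix g assume g: "g \<in> carrier G"
  then obtain b a z where baz: "b \<in> B" "a \<in> A" "z \<in> center G" "inv g = b \<otimes> a \<otimes> z"
    using factor[of "inv g"] by auto
  have "g = inv (b \<otimes> a \<otimes> z)" using baz(4) g by (metis inv_inv)
  also have "\<dots> = inv z \<otimes> (inv a \<otimes> inv b)" using baz by (simp add: inv_mult_group)
  also have "\<dots> = inv a \<otimes> inv b \<otimes> inv z"
    using baz by (simp add: center_commute[OF subgroup.m_inv_closed[OF center_subgroup baz(3)]])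
  finally show "\<exists>b\<in>A. \<exists>a\<in>B. \<exists>z\<in>center G. g = b \<otimes> a \<otimes> z"
    using subgroup.m_inv_closed[OF A baz(2)] subgroup.m_inv_closed[OF B baz(1)]
      subgroup.m_inv_closed[OF center_subgroup baz(3)] by blast
qed (fact A B comm_A comm_B A_center B_center)+

text \<open>As \<open>a\<close> commutes with \<open>A\<close> and with the center,
  \<open>[a, g]\<close> depends only on the \<open>B\<close>-component of \<open>g\<close>, so
  \<open>B\<close> yields the same commutators as the whole group.\<close>

lemma commutator_image_factor:
  assumes a: "a \<in> A" "a \<noteq> \<one>"
  shows "commutator G a ` B = center G"
proof -
  have na: "a \<notin> center G" using a A_center by blast
  have "commutator G a ` carrier G \<subseteq> commutator G a ` B"
  proof
    fix c assume "c \<in> commutator G a ` carrier G"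
    then obtain g where g: "g \<in> carrier G" "c = commutator G a g" by blast
    obtain b a' z where baz: "b \<in> B" "a' \<in> A" "z \<in> center G" "g = b \<otimes> a' \<otimes> z"
      using factor[OF g(1)] by blast
    have "commutator G a a' = \<one>" using commutator_eq_one_iff[of a a'] comm_A a baz by simp
    moreover have "commutator G a z = \<one>"
      using commutator_eq_one_iff[of a z] center_commute[of z a] a baz by simp
    ultimately have "c = commutator G a b"
      using g baz a by (simp add: commutator_biadditive)
    then show "c \<in> commutator G a ` B" using baz by blast
  qed
  moreover have "commutator G a ` B \<subseteq> commutator G a ` carrier G" by auto
  ultimately show ?thesis using commutator_image[of a] a na by auto
qed

section \<open>Counting commuting pairs\<close>

lemma finite_A: "finite A"
  using A finite_carrier by (meson finite_subset subgroup.subset)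

text \<open>The set is the kernel of the homomorphism \<open>b \<mapsto> [a, b]\<close> from
  \<open>B\<close> onto the center.\<close>

lemma card_commuting:
  assumes a: "a \<in> A" "a \<noteq> \<one>"
  shows "card {b \<in> B. a \<otimes> b = b \<otimes> a} * card (center G) = card B"
proof -
  interpret c: group_hom "G\<lparr>carrier := B\<rparr>" "G\<lparr>carrier := center G\<rparr>" "commutator G a"
  proof -
    have "commutator G a \<in> hom (G\<lparr>carrier := B\<rparr>) (G\<lparr>carrier := center G\<rparr>)"
      using a by (intro homI) (simp_all add: commutator_biadditive)
    then show "group_hom (G\<lparr>carrier := B\<rparr>) (G\<lparr>carrier := center G\<rparr>) (commutator G a)"
      using subgroup_imp_group B center_subgroup by (simp add: group_hom_def group_hom_axioms_def)
  qed
  have "kernel (G\<lparr>carrier := B\<rparr>) (G\<lparr>carrier := center G\<rparr>) (commutator G a) = {b \<in> B. a \<otimes> b = b \<otimes> a}"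
    using a by (auto simp: kernel_def commutator_eq_one_iff)
  then show ?thesis
    using c.card_kernel commutator_image_factor[OF a] by (simp add: order_def)
qed

text \<open>The row of \<open>\<one>\<close> contributes \<open>card B\<close>; each of the other
  \<open>card A - 1\<close> rows contributes \<open>card B\<close> divided by the order of the
  center. Multiplying by that order avoids the division.\<close>

lemma sum_card_commuting:
  "(\<Sum>a\<in>A. card {b \<in> B. a \<otimes> b = b \<otimes> a}) * card (center G)
     = card B * card (center G) + (card A - 1) * card B"
proof -
  have one: "\<one> \<in> A" using A subgroup.one_closed by blast
  have "{b \<in> B. \<one> \<otimes> b = b \<otimes> \<one>} = B" by auto
  then have "(\<Sum>a\<in>A. card {b \<in> B. a \<otimes> b = b \<otimes> a})
      = card B + (\<Sum>a\<in>A - {\<one>}. card {b \<in> B. a \<otimes> b = b \<otimes> a})"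
    using sum.remove[OF finite_A one, of "\<lambda>a. card {b \<in> B. a \<otimes> b = b \<otimes> a}"] by simp
  moreover have "(\<Sum>a\<in>A - {\<one>}. card {b \<in> B. a \<otimes> b = b \<otimes> a}) * card (center G)
      = (\<Sum>a\<in>A - {\<one>}. card B)"
    unfolding sum_distrib_right by (rule sum.cong) (auto simp: card_commuting)
  moreover have "(\<Sum>a\<in>A - {\<one>}. card B) = (card A - 1) * card B"
    using one finite_A by simp
  ultimately show ?thesis by (simp add: add_mult_distrib)
qed

lemma card_center_gt_1: "card (center G) > 1"
proof -
  have "\<one> \<in> center G" using center_subgroup subgroup.one_closed by blast
  then have "{\<one>} \<subset> center G" using nonabelian derived_eq_center by blast
  then have "card {\<one>} < card (center G)" using finite_center psubset_card_mono by blast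
  then show ?thesis by simp
qed

text \<open>Count the commuting pairs of \<open>A \<times> B\<close> by rows and by columns.\<close>
lemma card_A_eq_card_B: "card A = card B"
proof -
  interpret s: central_factorization G p B A by (rule central_factorization_swap)
  have "(\<Sum>a\<in>A. card {b \<in> B. a \<otimes> b = b \<otimes> a}) = (\<Sum>b\<in>B. card {a \<in> A. a \<otimes> b = b \<otimes> a})"
    by (rule sum_multicount_gen) (auto simp: finite_A s.finite_A)
  also have "\<dots> = (\<Sum>b\<in>B. card {a \<in> A. b \<otimes> a = a \<otimes> b})"
    by (simp only: eq_commute)
  finally have eq: "card B * card (center G) + (card A - 1) * card B
      = card A * card (center G) + (card B - 1) * card A"
    using sum_card_commuting s.sum_card_commuting by simp
  \<comment> \<open>Successor forms remove the natural subtractions from \<open>eq\<close>, which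
    becomes equality of \<open>card A\<close> and \<open>card B\<close> after both are multiplied by
    the order of the center minus 1. This factor is \<open>Suc k\<close>, so it cancels.\<close>
  have "card A > 0" "card B > 0"
    using subgroup.finite_imp_card_positive finite_carrier A B by blast+
  then obtain i j where "card A = Suc i" "card B = Suc j"
    using gr0_implies_Suc by blast
  moreover obtain k where "card (center G) = Suc (Suc k)"
    using less_imp_Suc_add[OF card_center_gt_1] by auto
  ultimately have "card B * Suc k = card A * Suc k" using eq by (simp add: algebra_simps)
  then show ?thesis by (simp only: mult_cancel2) simp
qed

section \<open>Uniqueness of the factorization\<close>

text \<open>For two factorizations of one element, \<open>inv b' \<otimes> b\<close> is an element
  of \<open>A\<close> times a central one, so it commutes with all of \<open>A\<close>. A nontrivial
  element of \<open>B\<close> cannot, since its commutators with \<open>A\<close> fill the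
  nontrivial center. Then \<open>inv a' \<otimes> a\<close> is central and in \<open>A\<close>,
  hence trivial.\<close>

lemma inj_on_factor: "inj_on (\<lambda>(b, a, z). b \<otimes> a \<otimes> z) (B \<times> A \<times> center G)"
proof -
  have unique: "b = b' \<and> a = a' \<and> z = z'"
    if m: "b \<in> B" "a \<in> A" "z \<in> center G" "b' \<in> B" "a' \<in> A" "z' \<in> center G"
      and eq: "b \<otimes> a \<otimes> z = b' \<otimes> a' \<otimes> z'" for b a z b' a' z'
  proof -
    let ?u = "inv b' \<otimes> b"
    have u: "?u \<in> B" using m B by (simp add: subgroup.m_closed subgroup.m_inv_closed)
    have iz: "inv z \<in> center G" using m center_subgroup by (simp add: subgroup.m_inv_closed)
    have "b \<otimes> a = b' \<otimes> a' \<otimes> z' \<otimes> inv z"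
      using eq m by (simp add: inv_solve_right)
    then have "b = b' \<otimes> a' \<otimes> z' \<otimes> inv z \<otimes> inv a"
      using m by (metis inv_closed inv_solve_right m_closed mem_carrier)
    then have "?u = inv b' \<otimes> (b' \<otimes> a' \<otimes> z' \<otimes> inv z \<otimes> inv a)" by simp
    also have "\<dots> = a' \<otimes> ((z' \<otimes> inv z) \<otimes> inv a)"
      using m by (simp add: m_assoc inv_solve_left')
    also have "\<dots> = (a' \<otimes> inv a) \<otimes> (z' \<otimes> inv z)"
      using m iz center_commute[of "z' \<otimes> inv z" "inv a"] subgroup.m_closed[OF center_subgroup]
      by (simp add: m_assoc)
    finally have uaz: "?u = (a' \<otimes> inv a) \<otimes> (z' \<otimes> inv z)" .
    have aa: "a' \<otimes> inv a \<in> A" and zz: "z' \<otimes> inv z \<in> center G"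
      using m iz A center_subgroup by (simp_all add: subgroup.m_closed subgroup.m_inv_closed)
    have uA: "commutator G x ?u = \<one>" if "x \<in> A" for x
      using that aa zz comm_A[of x "a' \<otimes> inv a"] center_commute[OF zz, of x]
        commutator_eq_one_iff[of x "a' \<otimes> inv a"] commutator_eq_one_iff[of x "z' \<otimes> inv z"]
      unfolding uaz by (simp add: commutator_biadditive)
    have "?u = \<one>"
    proof (rule ccontr)
      assume nu: "?u \<noteq> \<one>"
      interpret s: central_factorization G p B A by (rule central_factorization_swap)
      have "x \<otimes> ?u = ?u \<otimes> x" if "x \<in> A" for x
        using uA[OF that] that u commutator_eq_one_iff[of x ?u] by simp
      then have "commutator G ?u x = \<one>" if "x \<in> A" for x
        using that u commutator_eq_one_iff[of ?u x] by simp
      then have "center G \<subseteq> {\<one>}" using s.commutator_image_factor[OF u nu] by auto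
      then show False using card_center_gt_1 card_mono[of "{\<one>}" "center G"] by simp
    qed
    then have b: "b = b'" using m by (metis inv_closed inv_equality inv_inv mem_carrier(2))
    have "a \<otimes> z = a' \<otimes> z'" using eq m b by (simp add: m_assoc)
    then have "inv a' \<otimes> a = z' \<otimes> inv z"
      using m by (metis inv_closed inv_solve_left inv_solve_right m_assoc m_closed mem_carrier)
    moreover have "inv a' \<otimes> a \<in> A" using m A by (simp add: subgroup.m_closed subgroup.m_inv_closed)
    ultimately have "inv a' \<otimes> a = \<one>" using zz A_center by auto
    then have a: "a = a'" using m by (metis inv_closed inv_equality inv_inv mem_carrier(1))
    then show ?thesis using b eq m by simp
  qed
  show ?thesis by (intro inj_onI; clarsimp; rule unique; assumption)
qed

lemma image_factor: "(\<lambda>(b, a, z). b \<otimes> a \<otimes> z) ` (B \<times> A \<times> center G) = carrier G"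
proof
  show "carrier G \<subseteq> (\<lambda>(b, a, z). b \<otimes> a \<otimes> z) ` (B \<times> A \<times> center G)"
  proof
    fix g assume "g \<in> carrier G"
    then obtain b a z where "b \<in> B" "a \<in> A" "z \<in> center G" "g = b \<otimes> a \<otimes> z"
      using factor by blast
    then show "g \<in> (\<lambda>(b, a, z). b \<otimes> a \<otimes> z) ` (B \<times> A \<times> center G)"
      by (intro image_eqI[of _ _ "(b, a, z)"]) auto
  qed
qed auto

lemma order_eq: "order G = card B * (card A * card (center G))"
  using card_image[OF inj_on_factor] by (simp add: image_factor order_def card_cartesian_product)

section \<open>The map \<alpha> and the isomorphism with its group\<close>

context
  fixes V W :: "'a monoid" and \<phi>
  assumes V: "V = monoid.truncate (G\<lparr>carrier := A\<rparr>)"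
    and W: "W = monoid.truncate (G\<lparr>carrier := center G\<rparr>)"
    and \<phi>: "\<phi> \<in> iso (G\<lparr>carrier := A\<rparr>) (G\<lparr>carrier := B\<rparr>)"
begin

lemma \<phi>_closed [simp]: "a \<in> A \<Longrightarrow> \<phi> a \<in> B"
  using \<phi> by (auto simp: iso_def hom_def)

lemma \<phi>_mult [simp]: "a \<in> A \<Longrightarrow> a' \<in> A \<Longrightarrow> \<phi> (a \<otimes> a') = \<phi> a \<otimes> \<phi> a'"
  using \<phi> by (auto simp: iso_def hom_def)

lemma \<phi>_bij: "bij_betw \<phi> A B"
  using \<phi> by (simp add: iso_def)

lemma \<phi>_one: "\<phi> \<one> = \<one>"
  using hom_one[of \<phi> "G\<lparr>carrier := A\<rparr>" "G\<lparr>carrier := B\<rparr>"] \<phi> subgroup_imp_group A B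
  by (simp add: iso_def)

text \<open>Transport along \<open>\<phi>\<close> lets both arguments range over \<open>A\<close>.
  Surjectivity in the first argument comes from the swapped factorization, because
  \<open>[x, y]\<close> is the inverse of \<open>[y, x]\<close> and inversion permutes the
  center.\<close>

lemma generalized_nonsingular_commutator:
  "generalized_nonsingular V W (\<lambda>a b. commutator G a (\<phi> b))"
proof -
  interpret s: central_factorization G p B A by (rule central_factorization_swap)
  have inv_swap: "commutator G x y = inv (commutator G y x)" if "x \<in> carrier G" "y \<in> carrier G" for x y
    unfolding commutator_def using that by (simp add: inv_mult_group m_assoc)
  have 1: "(\<lambda>u. commutator G v (\<phi> u)) ` A = center G" if "v \<in> A" "v \<noteq> \<one>" for v
    using commutator_image_factor[OF that] \<phi>_bij by (metis bij_betw_def image_image)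
  have 2: "(\<lambda>u. commutator G u (\<phi> v)) ` A = center G" if v: "v \<in> A" "v \<noteq> \<one>" for v
  proof -
    have "\<phi> v \<noteq> \<one>"
      using v \<phi>_one \<phi>_bij A subgroup.one_closed unfolding bij_betw_def inj_on_def by metis
    then have "commutator G (\<phi> v) ` A = center G" using s.commutator_image_factor v by simp
    moreover have "(\<lambda>u. commutator G u (\<phi> v)) ` A = m_inv G ` commutator G (\<phi> v) ` A"
      unfolding image_image using v by (intro image_cong) (auto intro: inv_swap)
    moreover have "m_inv G ` center G = center G"
    proof -
      have "z \<in> m_inv G ` center G" if "z \<in> center G" for z
        using that subgroup.m_inv_closed[OF center_subgroup that] by (intro image_eqI[of _ _ "inv z"]) simp_all
      then show ?thesis using subgroup.m_inv_closed[OF center_subgroup] by blast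
    qed
    ultimately show ?thesis by simp
  qed
  have "(\<lambda>u. commutator G v (\<phi> u)) \<in> hom V W" if "v \<in> A" for v
    using that unfolding V W by (intro homI) (simp_all add: monoid.truncate_def commutator_biadditive)
  moreover have "(\<lambda>u. commutator G u (\<phi> v)) \<in> hom V W" if "v \<in> A" for v
    using that unfolding V W by (intro homI) (simp_all add: monoid.truncate_def commutator_biadditive)
  ultimately show ?thesis
    unfolding generalized_nonsingular_def using 1 2 by (simp add: V W monoid.truncate_def)
qed

lemma iso_group_of_map: "G \<cong> group_of_map V W (\<lambda>a b. commutator G a (\<phi> b))"
proof -
  let ?M = "group_of_map V W (\<lambda>a b. commutator G a (\<phi> b))"
  define f where "f = (\<lambda>(a, b, c). \<phi> b \<otimes> a \<otimes> c)"
  have carr: "carrier ?M = A \<times> A \<times> center G"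
    by (simp add: group_of_map_def V W monoid.truncate_def)
  have bij: "bij_betw f (A \<times> A \<times> center G) (carrier G)"
  proof -
    have "bij_betw (\<lambda>(a, b, c). (\<phi> b, a, c)) (A \<times> A \<times> center G) (B \<times> A \<times> center G)"
      using \<phi>_bij unfolding bij_betw_def inj_on_def by (auto simp: image_iff)
    moreover have "bij_betw (\<lambda>(b, a, z). b \<otimes> a \<otimes> z) (B \<times> A \<times> center G) (carrier G)"
      using inj_on_factor image_factor by (simp add: bij_betw_def)
    ultimately have "bij_betw ((\<lambda>(b, a, z). b \<otimes> a \<otimes> z) \<circ> (\<lambda>(a, b, c). (\<phi> b, a, c)))
        (A \<times> A \<times> center G) (carrier G)" by (rule bij_betw_trans)
    moreover have "(\<lambda>(b, a, z). b \<otimes> a \<otimes> z) \<circ> (\<lambda>(a, b, c). (\<phi> b, a, c)) = f"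
      by (auto simp: f_def)
    ultimately show ?thesis by simp
  qed
  \<comment> \<open>The \<open>B\<close>-factor stands first in \<open>f\<close>, so multiplying two
    values moves \<open>a1\<close> past \<open>\<phi> b2\<close>. The commutator this produces is
    exactly the twisting term of the multiplication in \<open>?M\<close>.\<close>
  have mult: "f ((a1, b1, c1) \<otimes>\<^bsub>?M\<^esub> (a2, b2, c2)) = f (a1, b1, c1) \<otimes> f (a2, b2, c2)"
    if m: "a1 \<in> A" "b1 \<in> A" "c1 \<in> center G" "a2 \<in> A" "b2 \<in> A" "c2 \<in> center G"
    for a1 b1 c1 a2 b2 c2
  proof -
    let ?d = "commutator G a1 (\<phi> b2)"
    have d: "?d \<in> center G" using m by simp
    have "f (a1, b1, c1) \<otimes> f (a2, b2, c2) = \<phi> b1 \<otimes> (a1 \<otimes> (c1 \<otimes> (\<phi> b2 \<otimes> a2)) \<otimes> c2)"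
      using m by (simp add: f_def m_assoc)
    also have "\<dots> = \<phi> b1 \<otimes> ((a1 \<otimes> \<phi> b2) \<otimes> a2 \<otimes> (c1 \<otimes> c2))"
      using m center_commute[of c1 "\<phi> b2 \<otimes> a2"] by (simp add: m_assoc)
    also have "\<dots> = \<phi> b1 \<otimes> (?d \<otimes> (\<phi> b2 \<otimes> a1 \<otimes> a2 \<otimes> (c1 \<otimes> c2)))"
      using m commutator_swap[of a1 "\<phi> b2"] by (simp add: m_assoc)
    also have "\<dots> = \<phi> b1 \<otimes> (\<phi> b2 \<otimes> a1 \<otimes> a2 \<otimes> (c1 \<otimes> c2) \<otimes> ?d)"
      using m center_commute[OF d, of "\<phi> b2 \<otimes> a1 \<otimes> a2 \<otimes> (c1 \<otimes> c2)"] by simp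
    also have "\<dots> = f ((a1, b1, c1) \<otimes>\<^bsub>?M\<^esub> (a2, b2, c2))"
      using m by (simp add: f_def group_of_map_def V W monoid.truncate_def m_assoc)
    finally show ?thesis by simp
  qed
  have inM: "x \<otimes>\<^bsub>?M\<^esub> y \<in> carrier ?M" if "x \<in> carrier ?M" "y \<in> carrier ?M" for x y
    using that A center_subgroup
    by (auto simp: group_of_map_def V W monoid.truncate_def intro!: subgroup.m_closed)
  \<comment> \<open>The goal asks for a map out of \<open>G\<close>, so the inverse of
    \<open>f\<close> is shown to be a homomorphism directly; closure of \<open>?M\<close> allows
    \<open>f\<close> to be cancelled on products.\<close>
  let ?g = "inv_into (carrier ?M) f"
  have bijM: "bij_betw f (carrier ?M) (carrier G)" using bij carr by simp
  have "?g \<in> hom G ?M"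
  proof (rule homI)
    show g: "?g x \<in> carrier ?M" if "x \<in> carrier G" for x
      using bij_betw_inv_into[OF bijM] that by (rule bij_betwE[rule_format])
    fix x y assume xy: "x \<in> carrier G" "y \<in> carrier G"
    have "f (?g x \<otimes>\<^bsub>?M\<^esub> ?g y) = f (?g x) \<otimes> f (?g y)"
      using g[OF xy(1)] g[OF xy(2)] mult unfolding carr by auto
    also have "\<dots> = x \<otimes> y" using xy bijM by (simp add: bij_betw_inv_into_right)
    finally show "?g (x \<otimes> y) = ?g x \<otimes>\<^bsub>?M\<^esub> ?g y"
      using inM[OF g[OF xy(1)] g[OF xy(2)]] bij_betw_inv_into_left[OF bijM] by metis
  qed
  then have "?g \<in> iso G ?M"
    using bij_betw_inv_into[OF bijM] by (simp add: iso_def)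
  then show ?thesis by (rule is_isoI)
qed

end

end

section \<open>Passage from the given factors to complements, and the orders\<close>

text \<open>The complement is that of \<open>A \<inter> center G\<close> inside \<open>A\<close>,
  since the center need not lie in \<open>A\<close>. Being contained in \<open>A\<close>, it then
  meets the whole center trivially.\<close>

lemma central_complement:
  assumes "group G" and A: "subgroup A G" "elementary_abelian p (G\<lparr>carrier := A\<rparr>)" "finite A"
  obtains A' where "subgroup A' G" "A' \<subseteq> A" "A' \<inter> center G = {\<one>\<^bsub>G\<^esub>}"
    "A \<subseteq> A' <#>\<^bsub>G\<^esub> center G"
proof -
  interpret group G by fact
  let ?A = "G\<lparr>carrier := A\<rparr>"
  have K: "subgroup (A \<inter> center G) ?A"
    using subgroup_incl[OF subgroups_Inter_pair[OF A(1) center_subgroup] A(1)] by blast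
  have triv: "subgroup {\<one>\<^bsub>?A\<^esub>} ?A"
    using group.triv_subgroup[OF subgroup_imp_group[OF A(1)]] .
  have finA: "finite (carrier ?A)" using A by simp
  obtain A' where A': "subgroup A' ?A" "A' \<inter> (A \<inter> center G) = {\<one>\<^bsub>?A\<^esub>}"
      "A' <#>\<^bsub>?A\<^esub> (A \<inter> center G) = carrier ?A"
    using elementary_abelian_complement[OF A(2) finA triv K Int_lower1] .
  have sub: "A' \<subseteq> A" using subgroup.subset[OF A'(1)] by simp
  moreover have "subgroup A' G" using incl_subgroup[OF A(1) A'(1)] .
  moreover have "A' \<inter> center G = {\<one>\<^bsub>G\<^esub>}" using A'(2) sub by auto
  moreover have "A \<subseteq> A' <#>\<^bsub>G\<^esub> center G"
    using A'(3) by (fastforce simp: set_mult_def)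
  ultimately show thesis using that by blast
qed

theorem theorem1p4:
  fixes G :: "('a, 'b) monoid_scheme" and p n m :: nat and A B :: "'a set"
  assumes "Factorial_Ring.prime p" and "n > 0" and "m > 0"
    and "semi_extraspecial p G"
    and "group_index G (derived G (carrier G)) = p ^ (2 * n)"
    and "card (derived G (carrier G)) = p ^ m"
    and "group_exponent G = p"
    and "subgroup A G" and "elementary_abelian p (G\<lparr>carrier := A\<rparr>)"
    and "subgroup B G" and "elementary_abelian p (G\<lparr>carrier := B\<rparr>)"
    and "carrier G = A <#>\<^bsub>G\<^esub> B"
  shows "\<exists>(V :: 'a monoid) (W :: 'a monoid) (\<alpha> :: 'a \<Rightarrow> 'a \<Rightarrow> 'a).
           elementary_abelian p V \<and> Coset.order V = p ^ n \<and>
           elementary_abelian p W \<and> Coset.order W = p ^ m \<and>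
           generalized_nonsingular V W \<alpha> \<and>
           G \<cong> group_of_map V W \<alpha>"
proof -
  interpret group G using assms(4) by (simp add: semi_extraspecial_def finite_p_group_def)
  have fin: "finite (carrier G)" using assms(4) by (simp add: semi_extraspecial_def finite_p_group_def)
  have finA: "finite A" and finB: "finite B"
    using assms(8,10) fin by (meson finite_subset subgroup.subset)+
  have pm: "p ^ m \<noteq> 1" using assms(1,3) prime_gt_1_nat[of p] by (simp add: less_imp_neq)
  interpret semi_extraspecial_group G p
  proof
    \<comment> \<open>The order of \<open>G\<close> is a witness for the \<open>LEAST\<close> in
      \<open>group_exponent\<close>, so the exponent has the defining property.\<close>
    have "0 < order G \<and> (\<forall>x\<in>carrier G. x [^]\<^bsub>G\<^esub> order G = \<one>\<^bsub>G\<^esub>)"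
      using fin pow_order_eq_1 order_gt_0_iff_finite by blast
    then have "0 < group_exponent G \<and> (\<forall>x\<in>carrier G. x [^]\<^bsub>G\<^esub> group_exponent G = \<one>\<^bsub>G\<^esub>)"
      unfolding group_exponent_def by (rule LeastI)
    then show "x [^]\<^bsub>G\<^esub> p = \<one>\<^bsub>G\<^esub>" if "x \<in> carrier G" for x
      using that assms(7) by simp
    show "derived G (carrier G) \<noteq> {\<one>\<^bsub>G\<^esub>}"
      using assms(6) pm by (metis card_1_singleton_iff One_nat_def)
  qed (rule assms(4))
  obtain A' where A': "subgroup A' G" "A' \<subseteq> A" "A' \<inter> center G = {\<one>\<^bsub>G\<^esub>}" "A \<subseteq> A' <#>\<^bsub>G\<^esub> center G"
    using central_complement[OF group_axioms assms(8,9) finA] .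
  obtain B' where B': "subgroup B' G" "B' \<subseteq> B" "B' \<inter> center G = {\<one>\<^bsub>G\<^esub>}" "B \<subseteq> B' <#>\<^bsub>G\<^esub> center G"
    using central_complement[OF group_axioms assms(10,11) finB] .
  have commA: "x \<otimes>\<^bsub>G\<^esub> y = y \<otimes>\<^bsub>G\<^esub> x" if "x \<in> A" "y \<in> A" for x y
    using comm_groupE(4)[of "G\<lparr>carrier := A\<rparr>" x y] assms(9) that by (simp add: elementary_abelian_def)
  have commB: "x \<otimes>\<^bsub>G\<^esub> y = y \<otimes>\<^bsub>G\<^esub> x" if "x \<in> B" "y \<in> B" for x y
    using comm_groupE(4)[of "G\<lparr>carrier := B\<rparr>" x y] assms(11) that by (simp add: elementary_abelian_def)
  \<comment> \<open>The roles are exchanged: the locale writes its second group first, while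
    \<open>carrier G = A <#> B\<close> puts \<open>A\<close> first. Hence \<open>V\<close> is built
    on \<open>B'\<close> and \<open>\<phi>\<close> maps \<open>B'\<close> to
    \<open>A'\<close>.\<close>
  interpret central_factorization G p B' A'
  proof (intro central_factorization.intro central_factorization_axioms.intro semi_extraspecial_group_axioms)
    fix g assume "g \<in> carrier G"
    then obtain a b where ab: "a \<in> A" "b \<in> B" "g = a \<otimes>\<^bsub>G\<^esub> b"
      using assms(12) by (auto simp: set_mult_def)
    obtain a' z where a': "a' \<in> A'" "z \<in> center G" "a = a' \<otimes>\<^bsub>G\<^esub> z"
      using ab(1) A'(4) by (auto simp: set_mult_def)
    obtain b' w where b': "b' \<in> B'" "w \<in> center G" "b = b' \<otimes>\<^bsub>G\<^esub> w"
      using ab(2) B'(4) by (auto simp: set_mult_def)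
    have c: "a' \<in> carrier G" "b' \<in> carrier G" "z \<in> carrier G" "w \<in> carrier G"
      using a' b' A'(1) B'(1) subgroup.mem_carrier center_in_carrier by metis+
    have "g = a' \<otimes>\<^bsub>G\<^esub> ((z \<otimes>\<^bsub>G\<^esub> b') \<otimes>\<^bsub>G\<^esub> w)" using ab a' b' c by (simp add: m_assoc)
    also have "\<dots> = a' \<otimes>\<^bsub>G\<^esub> b' \<otimes>\<^bsub>G\<^esub> (z \<otimes>\<^bsub>G\<^esub> w)"
      using c center_commute[OF a'(2) c(2)] by (simp add: m_assoc)
    finally show "\<exists>b\<in>A'. \<exists>a\<in>B'. \<exists>z\<in>center G. g = b \<otimes>\<^bsub>G\<^esub> a \<otimes>\<^bsub>G\<^esub> z"
      using a' b' subgroup.m_closed[OF center_subgroup] by blast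
  next
    show "x \<otimes>\<^bsub>G\<^esub> y = y \<otimes>\<^bsub>G\<^esub> x" if "x \<in> B'" "y \<in> B'" for x y
      using commB that B'(2) by blast
    show "x \<otimes>\<^bsub>G\<^esub> y = y \<otimes>\<^bsub>G\<^esub> x" if "x \<in> A'" "y \<in> A'" for x y
      using commA that A'(2) by blast
  qed (fact A' B')+
  let ?A = "G\<lparr>carrier := A'\<rparr>" and ?B = "G\<lparr>carrier := B'\<rparr>" and ?Z = "G\<lparr>carrier := center G\<rparr>"
  have eaA: "elementary_abelian p ?A" and eaB: "elementary_abelian p ?B"
    using elementary_abelian_subgroup[OF assms(9) subgroup_incl[OF A'(1) assms(8) A'(2)]]
      elementary_abelian_subgroup[OF assms(11) subgroup_incl[OF B'(1) assms(10) B'(2)]] by simp_all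
  have cardZ: "card (center G) = p ^ m" using assms(6) derived_eq_center by simp
  have "order G = p ^ (2 * n) * p ^ m"
    using lagrange[OF derived_is_subgroup[OF subset_refl]] assms(5,6) by (simp add: group_index_def)
  \<comment> \<open>Both expressions for the order of \<open>G\<close> contain the factor
    \<open>p ^ m\<close> of the center, which cancels because \<open>p\<close> is positive.\<close>
  then have "card B' * card B' = p ^ n * p ^ n"
    using order_eq card_A_eq_card_B cardZ prime_gt_0_nat[OF assms(1)]
    by (simp add: mult_2 power_add)
  then have cardB: "card B' = p ^ n" by (metis power2_eq_iff_nonneg power2_eq_square zero_le)
  have "order ?B = order ?A" using card_A_eq_card_B by (simp add: order_def)
  then have "?B \<cong> ?A"
    using elementary_abelian_iso[OF eaB eaA] finite_A by simp
  then obtain \<phi> where \<phi>: "\<phi> \<in> iso ?B ?A" by (auto simp: is_iso_def)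
  let ?V = "monoid.truncate ?B" and ?W = "monoid.truncate ?Z"
  have "elementary_abelian p ?V" "elementary_abelian p ?W"
    using elementary_abelian_truncate eaB elementary_abelian_center by blast+
  moreover have "order ?V = p ^ n" "order ?W = p ^ m"
    using cardB cardZ by (simp_all add: order_def monoid.truncate_def)
  ultimately show ?thesis
    using generalized_nonsingular_commutator[OF refl refl \<phi>] iso_group_of_map[OF refl refl \<phi>]
    by blast
qed

end
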